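(* Let $a \le b$ be real numbers, let $\gamma\colon[a,b]\to\mathbb{R}^3$ be a rectifiable curve, and let $\Gamma=\gamma([a,b])$ be its range. Then the set $\frac{1}{2}(\Gamma+\Gamma)$ has zero Lebesgue measure in $\mathbb{R}^3$.
   Context: For sets $A,B\subseteq\mathbb{R}^n$, $A+B$ denotes the Minkowski sum $\{x+y : x\in A,\ y\in B\}$, and for $r\in\mathbb{R}$, $rA=\{rx : x\in A\}$. A rectifiable curve in $\mathbb{R}^3$ is a continuous map $\gamma\colon[a,b]\to\mathbb{R}^3$ of finite length, where the length is the supremum of $\sum_{i}|\gamma(t_{i+1})-\gamma(t_i)|$ over all finite partitions $a=t_0\le t_1\le\dots\le t_m=b$. *)

theory Defs
  imports "HOL-Analysis.Analysis"
begin

text \<open>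
  A finite partition \<open>a = t\<^sub>0 \<le> \<dots> \<le> t\<^sub>m = b\<close> is represented by \<open>m\<close> together with a sequence
  \<open>t\<close> of which only the values at indices up to \<open>m\<close> matter. The supremum is taken in
  the extended reals, so the length of an arbitrary map is defined and may be infinite
  (for \<open>a > b\<close> there are no partitions and the value is meaningless).
\<close>

definition partition_of_interval :: "real \<Rightarrow> real \<Rightarrow> nat \<Rightarrow> (nat \<Rightarrow> real) \<Rightarrow> bool" where
  "partition_of_interval a b m t \<longleftrightarrow> t 0 = a \<and> t m = b \<and> (\<forall>i<m. t i \<le> t (Suc i))"

definition curve_length :: "real \<Rightarrow> real \<Rightarrow> (real \<Rightarrow> 'a::real_normed_vector) \<Rightarrow> ereal" where
  "curve_length a b \<gamma> =
     Sup {ereal (\<Sum>i<m. norm (\<gamma> (t (Suc i)) - \<gamma> (t i))) | m t. partition_of_interval a b m t}"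

definition rectifiable_curve :: "real \<Rightarrow> real \<Rightarrow> (real \<Rightarrow> 'a::real_normed_vector) \<Rightarrow> bool" where
  "rectifiable_curve a b \<gamma> \<longleftrightarrow> continuous_on {a..b} \<gamma> \<and> curve_length a b \<gamma> < \<infinity>"

end

theory Submission
  imports Defs
begin

text \<open>
  A curve of length less than \<open>M\<close> can be cut into \<open>N\<close> pieces of length at most \<open>M / N\<close>, so its
  range is covered by \<open>N\<close> balls of radius \<open>M / N\<close> (\<open>rectifiable_curve_ball_cover\<close>). The
  midpoint of a point of \<open>cball c r\<close> and a point of \<open>cball d r\<close> lies in the ball of radius
  \<open>r\<close> about the midpoint of \<open>c\<close> and \<open>d\<close>. Hence the set of midpoints is covered by \<open>N\<^sup>2\<close> balls
  of radius \<open>M / N\<close>, whose total volume in dimension three is at most a constant times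
  \<open>N\<^sup>2 (M / N)\<^sup>3 = M\<^sup>3 / N\<close>, and this tends to \<open>0\<close> (\<open>negligible_midpoints\<close>).

  In other words, the range has upper box dimension at most one, and its set of midpoints
  has upper box dimension at most two.
\<close>

section \<open>Cutting a rectifiable curve into short pieces\<close>

lemma curve_length_nonneg:
  assumes "a \<le> b"
  shows "0 \<le> curve_length a b \<gamma>"
proof -
  define t where "t i = (if i = 0 then a else b)" for i :: nat
  have "partition_of_interval a b 1 t"
    using assms by (simp add: partition_of_interval_def t_def)
  then have "ereal (\<Sum>i<1. norm (\<gamma> (t (Suc i)) - \<gamma> (t i))) \<le> curve_length a b \<gamma>"
    unfolding curve_length_def by (intro Sup_upper) blast
  then show ?thesis
    by (rule order_trans[rotated]) (simp add: sum_nonneg)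
qed

text \<open>
  Appending \<open>t\<close> to a partition of \<open>[a, s]\<close> gives a partition of \<open>[a, t]\<close>, whose sum has the
  chord from \<open>s\<close> to \<open>t\<close> as an additional term.
\<close>

lemma curve_length_add_chord_le:
  assumes "s \<le> t"
  shows "curve_length a s \<gamma> + ereal (norm (\<gamma> t - \<gamma> s)) \<le> curve_length a t \<gamma>"
proof -
  have "curve_length a s \<gamma> \<le> curve_length a t \<gamma> - ereal (norm (\<gamma> t - \<gamma> s))"
    unfolding curve_length_def[of a s]
  proof (rule Sup_least, clarify)
    fix m p assume p: "partition_of_interval a s m p"
    define q where "q = p(Suc m := t)"
    have q: "partition_of_interval a t (Suc m) q"
      using p assms by (auto simp: partition_of_interval_def q_def less_Suc_eq)
    have "ereal (\<Sum>i<Suc m. norm (\<gamma> (q (Suc i)) - \<gamma> (q i))) \<le> curve_length a t \<gamma>"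
      unfolding curve_length_def using q by (intro Sup_upper) blast
    moreover have "(\<Sum>i<Suc m. norm (\<gamma> (q (Suc i)) - \<gamma> (q i))) =
        (\<Sum>i<m. norm (\<gamma> (p (Suc i)) - \<gamma> (p i))) + norm (\<gamma> t - \<gamma> s)"
      using p by (simp add: q_def partition_of_interval_def)
    ultimately show "ereal (\<Sum>i<m. norm (\<gamma> (p (Suc i)) - \<gamma> (p i)))
        \<le> curve_length a t \<gamma> - ereal (norm (\<gamma> t - \<gamma> s))"
      by (simp add: ereal_le_minus)
  qed
  then show ?thesis
    by (simp add: ereal_le_minus)
qed

text \<open>
  The arc length \<open>V\<close> measured from the left end point controls chords,
  which reduces the covering of the curve to that of an interval of the real line.
\<close>

lemma rectifiable_curve_arc_length:
  assumes "a \<le> b" and "rectifiable_curve a b \<gamma>"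
  obtains V :: "real \<Rightarrow> real" and L :: real
  where "\<And>t. t \<in> {a..b} \<Longrightarrow> 0 \<le> V t \<and> V t \<le> L"
    and "\<And>s t. s \<in> {a..b} \<Longrightarrow> t \<in> {a..b} \<Longrightarrow> dist (\<gamma> s) (\<gamma> t) \<le> \<bar>V s - V t\<bar>"
proof -
  define V where "V t = real_of_ereal (curve_length a t \<gamma>)" for t
  have le: "curve_length a s \<gamma> \<le> curve_length a t \<gamma>" if "s \<le> t" for s t
  proof -
    have "curve_length a s \<gamma> + 0 \<le> curve_length a s \<gamma> + ereal (norm (\<gamma> t - \<gamma> s))"
      by (intro add_left_mono) simp
    then show ?thesis
      using curve_length_add_chord_le[OF that, of a \<gamma>] by simp
  qed
  have V: "curve_length a t \<gamma> = ereal (V t)" if "t \<in> {a..b}" for t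
  proof -
    have "0 \<le> curve_length a t \<gamma>" "curve_length a t \<gamma> < \<infinity>"
      using that assms le[of t b] curve_length_nonneg[of a t \<gamma>]
      by (auto simp: rectifiable_curve_def)
    then show ?thesis
      by (cases "curve_length a t \<gamma>") (auto simp: V_def)
  qed
  have bounds: "0 \<le> V t \<and> V t \<le> V b" if "t \<in> {a..b}" for t
    using that assms(1) le[of t b] curve_length_nonneg[of a t \<gamma>] V[of t] V[of b] by auto
  have chord: "dist (\<gamma> s) (\<gamma> t) \<le> V t - V s" if "s \<in> {a..b}" "t \<in> {a..b}" "s \<le> t" for s t
    using curve_length_add_chord_le[OF that(3), of a \<gamma>] V[OF that(1)] V[OF that(2)]
    by (simp add: dist_norm norm_minus_commute)
  have "dist (\<gamma> s) (\<gamma> t) \<le> \<bar>V s - V t\<bar>" if "s \<in> {a..b}" "t \<in> {a..b}" for s t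
    using chord[OF that] chord[OF that(2) that(1)]
    by (cases "s \<le> t") (auto simp: dist_commute)
  with bounds show thesis
    by (rule that)
qed

text \<open>
  The parameters are sorted into \<open>N\<close> bins according to the arc length reached so far; points
  whose parameters share a bin are at distance at most the width \<open>M / N\<close> of the bin. Choosing
  one point for each nonempty bin gives the centres.
\<close>

lemma rectifiable_curve_ball_cover:
  fixes \<gamma> :: "real \<Rightarrow> 'a::real_normed_vector"
  assumes "a \<le> b" and "rectifiable_curve a b \<gamma>"
  obtains M :: real
  where "0 < M"
    and "\<And>N::nat. 0 < N \<Longrightarrow>
      \<exists>C. finite C \<and> card C \<le> N \<and> \<gamma> ` {a..b} \<subseteq> (\<Union>c\<in>C. cball c (M / N))"
proof -
  obtain V L
    where V: "\<And>t. t \<in> {a..b} \<Longrightarrow> 0 \<le> V t \<and> V t \<le> L"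
      and chord: "\<And>s t. s \<in> {a..b} \<Longrightarrow> t \<in> {a..b} \<Longrightarrow> dist (\<gamma> s) (\<gamma> t) \<le> \<bar>V s - V t\<bar>"
    using rectifiable_curve_arc_length[OF assms] by blast
  \<comment> \<open>The strict inequality \<open>V t < M\<close> makes the bins \<open>0, \<dots>, N - 1\<close> suffice, and \<open>M > 0\<close> lets
    the width be positive for a constant curve as well.\<close>
  define M where "M = L + 1"
  have M: "0 < M"
    using V[of a] assms(1) by (simp add: M_def)
  show thesis
  proof (rule that[OF M])
    fix N :: nat assume N: "0 < N"
    define \<delta> where "\<delta> = M / N"
    have \<delta>: "0 < \<delta>"
      using M N by (simp add: \<delta>_def)
    define bin where "bin t = nat \<lfloor>V t / \<delta>\<rfloor>" for t
    have bin_less: "bin t < N" if "t \<in> {a..b}" for t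
    proof -
      have "V t / \<delta> < N"
        using V[OF that] \<delta> N by (simp add: pos_divide_less_eq \<delta>_def M_def)
      then show ?thesis
        using V[OF that] \<delta> N by (simp add: bin_def nat_less_iff floor_less_iff)
    qed
    have bin_close: "dist (\<gamma> s) (\<gamma> t) \<le> \<delta>"
      if "s \<in> {a..b}" "t \<in> {a..b}" "bin s = bin t" for s t
    proof -
      have "\<lfloor>V s / \<delta>\<rfloor> = \<lfloor>V t / \<delta>\<rfloor>"
        using that V[OF that(1)] V[OF that(2)] \<delta> by (simp add: bin_def eq_nat_nat_iff)
      then have "\<bar>V s / \<delta> - V t / \<delta>\<bar> \<le> 1"
        by linarith
      then have "\<bar>V s - V t\<bar> \<le> \<delta>"
        using \<delta> by (simp flip: diff_divide_distrib)
      then show ?thesis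
        using chord[OF that(1,2)] by linarith
    qed
    define rep where "rep k = (SOME t. t \<in> {a..b} \<and> bin t = k)" for k
    have rep: "rep (bin t) \<in> {a..b} \<and> bin (rep (bin t)) = bin t" if "t \<in> {a..b}" for t
      unfolding rep_def using that by (intro someI[of "\<lambda>s. s \<in> {a..b} \<and> bin s = bin t" t]) simp
    define C where "C = (\<lambda>k. \<gamma> (rep k)) ` {..<N}"
    have "card C \<le> N"
      unfolding C_def using card_image_le[of "{..<N}"] by simp
    moreover have "\<gamma> ` {a..b} \<subseteq> (\<Union>c\<in>C. cball c \<delta>)"
    proof (rule image_subsetI)
      fix t assume t: "t \<in> {a..b}"
      have "\<gamma> (rep (bin t)) \<in> C" "\<gamma> t \<in> cball (\<gamma> (rep (bin t))) \<delta>"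
        using bin_less[OF t] bin_close rep[OF t] t by (auto simp: C_def)
      then show "\<gamma> t \<in> (\<Union>c\<in>C. cball c \<delta>)"
        by blast
    qed
    ultimately show "\<exists>C. finite C \<and> card C \<le> N \<and> \<gamma> ` {a..b} \<subseteq> (\<Union>c\<in>C. cball c (M / N))"
      unfolding \<delta>_def by (intro exI[of _ C]) (simp add: C_def)
  qed
qed

section \<open>Midpoints of a set covered by few small balls\<close>

lemma midpoint_in_cball:
  fixes x y c d :: "'a::real_normed_vector"
  assumes "x \<in> cball c r" and "y \<in> cball d r"
  shows "midpoint x y \<in> cball (midpoint c d) r"
proof -
  have "midpoint c d - midpoint x y = (1 / 2) *\<^sub>R ((c - x) + (d - y))"
    by (simp add: midpoint_def algebra_simps)
  then have "dist (midpoint c d) (midpoint x y) = norm ((c - x) + (d - y)) / 2"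
    by (simp add: dist_norm)
  also have "\<dots> \<le> r"
    using assms norm_triangle_ineq[of "c - x" "d - y"] by (simp add: dist_norm)
  finally show ?thesis
    by simp
qed

lemma measure_Union_cball_le:
  fixes f :: "'i \<Rightarrow> 'a::euclidean_space"
  assumes "finite I" and "0 \<le> r"
  shows "measure lebesgue (\<Union>i\<in>I. cball (f i) r) \<le> card I * (unit_ball_vol DIM('a) * r ^ DIM('a))"
proof -
  have "measure lebesgue (\<Union>i\<in>I. cball (f i) r) \<le> (\<Sum>i\<in>I. measure lebesgue (cball (f i) r))"
    using assms(1) by (intro measure_UNION_le) auto
  also have "\<dots> = card I * (unit_ball_vol DIM('a) * r ^ DIM('a))"
    using assms(2) by (simp add: content_cball)
  finally show ?thesis .
qed

text \<open>
  In dimension \<open>n\<close> the \<open>N\<^sup>2\<close> balls around the midpoints of the centres have total volume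
  \<open>\<omega>\<^sub>n M\<^sup>n N\<^sup>2 / N\<^sup>n\<close>, which is at most \<open>\<omega>\<^sub>n M\<^sup>n / N\<close> as soon as \<open>n \<ge> 3\<close>.
\<close>

lemma negligible_midpoints:
  fixes S :: "'a::euclidean_space set"
  assumes dim: "3 \<le> DIM('a)" and M: "0 < M"
    and cover: "\<And>N::nat. 0 < N \<Longrightarrow>
      \<exists>C. finite C \<and> card C \<le> N \<and> S \<subseteq> (\<Union>c\<in>C. cball c (M / N))"
  shows "negligible {midpoint x y | x y. x \<in> S \<and> y \<in> S}"
  unfolding negligible_outer_le
proof (intro allI impI)
  fix e :: real assume e: "0 < e"
  define K where "K = unit_ball_vol (real DIM('a)) * M ^ DIM('a)"
  have K: "0 \<le> K"
    using M by (simp add: K_def)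
  obtain N :: nat where N: "0 < N" "K / N \<le> e"
  proof -
    obtain N :: nat where "K / e < N"
      using reals_Archimedean2 by blast
    moreover from this have "0 < real N"
      using K e by (meson divide_nonneg_pos le_less_trans)
    ultimately show thesis
      using e by (intro that[of N]) (auto simp: field_simps)
  qed
  obtain C where C: "finite C" "card C \<le> N" "S \<subseteq> (\<Union>c\<in>C. cball c (M / N))"
    using cover[OF N(1)] by blast
  define T where "T = (\<Union>p\<in>C \<times> C. cball (midpoint (fst p) (snd p)) (M / N))"
  have "{midpoint x y | x y. x \<in> S \<and> y \<in> S} \<subseteq> T"
  proof clarify
    fix x y assume "x \<in> S" "y \<in> S"
    then obtain c d where "c \<in> C" "d \<in> C" "x \<in> cball c (M / N)" "y \<in> cball d (M / N)"
      using C(3) by blast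
    then show "midpoint x y \<in> T"
      unfolding T_def using midpoint_in_cball by (intro UN_I[of "(c, d)"]) auto
  qed
  moreover have "T \<in> lmeasurable"
    unfolding T_def using C(1) by (intro fmeasurable.finite_UN) auto
  moreover have "measure lebesgue T \<le> e"
  proof -
    have "measure lebesgue T \<le>
        card (C \<times> C) * (unit_ball_vol (real DIM('a)) * (M / N) ^ DIM('a))"
      unfolding T_def using C(1) M by (intro measure_Union_cball_le) auto
    also have "\<dots> = real (card C) ^ 2 * (K / real N ^ DIM('a))"
      by (simp add: card_cartesian_product K_def power_divide power2_eq_square)
    also have "\<dots> \<le> real N ^ 2 * (K / real N ^ 3)"
      using C(2) K N(1) dim
      by (intro mult_mono power_mono divide_left_mono power_increasing) auto
    also have "\<dots> = K / N"
      using N(1) by (simp add: power2_eq_square power3_eq_cube)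
    finally show ?thesis
      using N(2) by simp
  qed
  ultimately show "\<exists>T. {midpoint x y | x y. x \<in> S \<and> y \<in> S} \<subseteq> T \<and> T \<in> lmeasurable \<and>
      measure lebesgue T \<le> e"
    by blast
qed

theorem theorem1:
  fixes a b :: real and \<gamma> :: "real \<Rightarrow> real ^ 3" and \<Gamma> :: "(real ^ 3) set"
  assumes "a \<le> b"
    and "rectifiable_curve a b \<gamma>"
    and "\<Gamma> = \<gamma> ` {a..b}"
  shows "(\<lambda>x. (1 / 2) *\<^sub>R x) ` (\<Gamma> + \<Gamma>) \<in> null_sets lebesgue"
proof -
  obtain M :: real where M: "0 < M"
    and cover: "\<And>N::nat. 0 < N \<Longrightarrow>
      \<exists>C. finite C \<and> card C \<le> N \<and> \<Gamma> \<subseteq> (\<Union>c\<in>C. cball c (M / N))"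
    using rectifiable_curve_ball_cover[OF assms(1,2)] unfolding assms(3) by blast
  have "negligible {midpoint x y | x y. x \<in> \<Gamma> \<and> y \<in> \<Gamma>}"
    by (rule negligible_midpoints[OF _ M cover]) simp_all
  moreover have "(\<lambda>x. (1 / 2) *\<^sub>R x) ` (\<Gamma> + \<Gamma>) = {midpoint x y | x y. x \<in> \<Gamma> \<and> y \<in> \<Gamma>}"
    by (auto simp: set_plus_def midpoint_def image_iff)
  ultimately show ?thesis
    by (simp add: negligible_iff_null_sets)
qed

end
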